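(* Let $G$ be a group and let $(\Gamma,\Psi)$ be a connected $G$-gain graph on $n$ vertices. Let $A\in M_n(\mathbb{C}G)$ be the adjacency matrix of $(\Gamma,\Psi)$ and let $|A|\in M_n(\mathbb{C}G)$ be the adjacency matrix of $(\Gamma,\mathbf{1}_G)$. The following are equivalent: (i) $(\Gamma,\Psi)$ is balanced; (ii) $Tr(A^h)=Tr(|A|^h)$ for every $h\in\mathbb{N}$; (iii) as $h\to\infty$, if $\Gamma$ is not bipartite then $\dfrac{Tr(A^{h})}{Tr(|A|^{h})}=\dfrac{|\mathcal{C}_b^h|}{|\mathcal{C}^h|}\to 1$, and if $\Gamma$ is bipartite then $\dfrac{Tr(A^{2h})}{Tr(|A|^{2h})}=\dfrac{|\mathcal{C}_b^{2h}|}{|\mathcal{C}^{2h}|}\to 1$.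
   Context: $G$ is an arbitrary (finite or infinite) group with identity $1_G$, and $\mathbb{N}$ denotes the positive integers. $\Gamma=(V_\Gamma,E_\Gamma)$ is a finite simple graph (no loops, no multiple edges) whose edges are regarded as ordered pairs, with $(v,u)\in E_\Gamma$ if and only if $(u,v)\in E_\Gamma$; write $u\sim v$ if $(u,v)\in E_\Gamma$. A $G$-gain function on $\Gamma$ is a map $\Psi\colon E_\Gamma\to G$ with $\Psi(u,v)=\Psi(v,u)^{-1}$; the pair $(\Gamma,\Psi)$ is a $G$-gain graph, and it is connected if $\Gamma$ is connected. $\mathbf{1}_G$ is the trivial gain function, constantly equal to $1_G$. Fix an order $v_1,\dots,v_n$ of $V_\Gamma$. $M_n(\mathbb{C}G)$ is the algebra of $n\times n$ matrices over the group algebra $\mathbb{C}G$. The adjacency matrix of $(\Gamma,\Psi)$ is the matrix in $M_n(\mathbb{C}G)$ whose $(i,j)$ entry is $\Psi(v_i,v_j)$ if $(v_i,v_j)\in E_\Gamma$ and $0$ otherwise. For $f=\sum_{g\in G}f_g g\in\mathbb{C}G$ put $Tr(f)=f_{1_G}$, and for $B\in M_n(\mathbb{C}G)$ put $Tr(B)=\sum_{i=1}^n Tr(B_{i,i})$. A walk $W$ of length $h$ is a sequence of $h+1$ vertices $w_0,w_1,\dots,w_h$ with $w_i\sim w_{i+1}$; its gain is $\Psi(W)=\Psi(w_0,w_1)\cdots\Psi(w_{h-1},w_h)$. It is closed if $w_0=w_h$. $(\Gamma,\Psi)$ is balanced if $\Psi(C)=1_G$ for every closed walk $C$. $\mathcal{C}^h$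 is the set of all closed walks of length $h$ in $\Gamma$ and $\mathcal{C}_b^h=\{C\in\mathcal{C}^h:\Psi(C)=1_G\}$. In (iii) the quotients are considered only for those $h$ for which the denominator is nonzero: convergence to $1$ means that for every $\varepsilon>0$ there is $N$ such that the quotient is within $\varepsilon$ of $1$ for all $h\ge N$ with nonzero denominator. *)

theory Defs
  imports
    Complex_Main
    "HOL-Library.Poly_Mapping"
    "Jordan_Normal_Form.Matrix"
    "Graph_Theory.Graph_Theory"
begin

text \<open>
  The group \<open>G\<close> is a type of class \<^class>\<open>group_add\<close>. This class does not require
  commutativity; the additive notation is only the one under which \<^theory>\<open>HOL-Library.Poly_Mapping\<close>
  provides monoid rings. So \<open>0\<close> is the identity of \<open>G\<close>, \<open>g + h\<close> is the product \<open>g h\<close>, and \<open>- g\<close>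
  is the inverse of \<open>g\<close>.

  The group algebra of \<open>G\<close> is the type of finitely supported functions \<open>'g \<Rightarrow>\<^sub>0 complex\<close> with its
  convolution product; \<open>Poly_Mapping.single g 1\<close> is the basis element \<open>g\<close>.
\<close>

type_synonym 'g group_algebra = "'g \<Rightarrow>\<^sub>0 complex"

text \<open>
  A \<^locale>\<open>pair_graph\<close> is a finite simple graph given by a symmetric, irreflexive set of ordered
  pairs. The values of a gain function outside the edge set are irrelevant.
\<close>

locale gain_graph = pair_graph \<Gamma>
  for \<Gamma> :: "'v pair_pre_digraph" +
  fixes \<Psi> :: "'v \<times> 'v \<Rightarrow> 'g :: group_add"
  assumes gain_inverse: "(u, v) \<in> parcs \<Gamma> \<Longrightarrow> \<Psi> (u, v) = - \<Psi> (v, u)"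

definition trivial_gain :: "'v \<times> 'v \<Rightarrow> 'g :: group_add" where
  "trivial_gain = (\<lambda>_. 0)"

definition bipartite :: "'v pair_pre_digraph \<Rightarrow> bool" where
  "bipartite \<Gamma> \<longleftrightarrow>
    (\<exists>U W. pverts \<Gamma> = U \<union> W \<and> U \<inter> W = {} \<and> parcs \<Gamma> \<subseteq> U \<times> W \<union> W \<times> U)"

text \<open>
  \<^const>\<open>sum_list\<close> respects the order of the list, so this is the product of the gains along
  the walk, from the first edge to the last.
\<close>

definition walk_gain :: "('v \<times> 'v \<Rightarrow> 'g :: group_add) \<Rightarrow> 'v vwalk \<Rightarrow> 'g" where
  "walk_gain \<Psi> w = sum_list (map \<Psi> (vwalk_arcs w))"

definition closed_walks :: "'v pair_pre_digraph \<Rightarrow> nat \<Rightarrow> 'v vwalk set" where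
  "closed_walks \<Gamma> h = {w. vwalk w (with_proj \<Gamma>) \<and> length w = h + 1 \<and> hd w = last w}"

definition balanced_closed_walks ::
    "'v pair_pre_digraph \<Rightarrow> ('v \<times> 'v \<Rightarrow> 'g :: group_add) \<Rightarrow> nat \<Rightarrow> 'v vwalk set" where
  "balanced_closed_walks \<Gamma> \<Psi> h = {w \<in> closed_walks \<Gamma> h. walk_gain \<Psi> w = 0}"

definition balanced :: "'v pair_pre_digraph \<Rightarrow> ('v \<times> 'v \<Rightarrow> 'g :: group_add) \<Rightarrow> bool" where
  "balanced \<Gamma> \<Psi> \<longleftrightarrow> (\<forall>h. \<forall>w \<in> closed_walks \<Gamma> h. walk_gain \<Psi> w = 0)"

text \<open>The list \<open>vs\<close> enumerates the vertices without repetition.\<close>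

definition adjacency_matrix ::
    "'v pair_pre_digraph \<Rightarrow> ('v \<times> 'v \<Rightarrow> 'g :: group_add) \<Rightarrow> 'v list \<Rightarrow> 'g group_algebra mat" where
  "adjacency_matrix \<Gamma> \<Psi> vs = mat (length vs) (length vs)
    (\<lambda>(i, j). if (vs ! i, vs ! j) \<in> parcs \<Gamma>
      then Poly_Mapping.single (\<Psi> (vs ! i, vs ! j)) 1 else 0)"

definition algebra_Tr :: "'g :: group_add group_algebra \<Rightarrow> complex" where
  "algebra_Tr f = Poly_Mapping.lookup f 0"

definition Tr :: "'g :: group_add group_algebra mat \<Rightarrow> complex" where
  "Tr B = (\<Sum>i<dim_row B. algebra_Tr (B $$ (i, i)))"

text \<open>Indices at which the denominator \<open>b\<close> vanishes are ignored.\<close>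

definition quotient_tends_to_1 :: "(nat \<Rightarrow> complex) \<Rightarrow> (nat \<Rightarrow> complex) \<Rightarrow> bool" where
  "quotient_tends_to_1 a b \<longleftrightarrow>
    (\<forall>\<epsilon>>0. \<exists>N. \<forall>h\<ge>N. b h \<noteq> 0 \<longrightarrow> dist (a h / b h) 1 < \<epsilon>)"

end

theory Submission
  imports Defs "HOL-Analysis.Convex"
begin

text \<open>
  The \<open>(i, j)\<close> entry of \<open>A\<^sup>h\<close> is the sum of the gains of the walks of length \<open>h\<close> from \<open>v\<^sub>i\<close> to
  \<open>v\<^sub>j\<close>, so the traces of \<open>A\<^sup>h\<close> and \<open>|A|\<^sup>h\<close> are the numbers \<open>b h\<close> and \<open>c h\<close> of balanced and of
  all closed walks. Only the implication from (iii) to (i) is not immediate.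

  If some closed walk is unbalanced, conjugating it along paths and padding with back-and-forth
  steps yields a number \<open>L\<close> such that every vertex carries an unbalanced closed walk of length \<open>L\<close>.
  Appending these walks to balanced ones gives \<open>b (2h) \<le> c (2h + L) - b (2h + L)\<close>. Since \<open>c (2h)\<close>
  is the sum of the squares of the numbers of walks of length \<open>h\<close> between two vertices,
  \<open>c (2h + L) \<le> K c (2h)\<close> for a constant \<open>K\<close>. As \<open>b (2h) / c (2h)\<close> tends to 1, the fraction of
  unbalanced closed walks of length \<open>2h + L\<close> is bounded away from 0. In a bipartite graph \<open>L\<close> is
  even, so these lengths are among those considered in (iii).
\<close>

section \<open>Walks between two vertices: concatenation, recursion and parity\<close>

definition walks :: "'v pair_pre_digraph \<Rightarrow> nat \<Rightarrow> 'v \<Rightarrow> 'v \<Rightarrow> 'v vwalk set" where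
  "walks \<Gamma> h u v = {w. vwalk w (with_proj \<Gamma>) \<and> length w = h + 1 \<and> hd w = u \<and> last w = v}"

lemma closed_walks_iff: "w \<in> closed_walks \<Gamma> h \<longleftrightarrow> w \<in> walks \<Gamma> h (hd w) (hd w)"
  by (auto simp: closed_walks_def walks_def)

lemma walks_subset_closed_walks: "walks \<Gamma> h u u \<subseteq> closed_walks \<Gamma> h"
  by (auto simp: closed_walks_def walks_def)

lemma walks_hd_in_verts: "w \<in> walks \<Gamma> h u v \<Longrightarrow> u \<in> pverts \<Gamma>"
  by (cases w) (auto simp: walks_def vwalk_def)

lemma walks_0: "walks \<Gamma> 0 u v = (if u = v \<and> u \<in> pverts \<Gamma> then {[u]} else {})"
  by (auto simp: walks_def vwalk_def length_Suc_conv)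

lemma walk_gain_single [simp]: "walk_gain \<Psi> [u] = 0"
  by (simp add: walk_gain_def)

text \<open>Walks are vertex lists, so joining two of them drops the repeated middle vertex by
  \<open>tl\<close>. A second walk of length 0 contributes no arc and is treated separately.\<close>

lemma walk_gain_append_tl:
  assumes "w \<noteq> []" "w' \<noteq> []" "last w = hd w'"
  shows "walk_gain \<Psi> (w @ tl w') = walk_gain \<Psi> w + walk_gain \<Psi> w'"
proof (cases "tl w' = []")
  case True
  with assms show ?thesis by (cases w') (auto simp: walk_gain_def)
next
  case False
  with assms show ?thesis by (cases w') (auto simp: walk_gain_def vwalk_arcs_append)
qed

lemma walks_append_tl:
  assumes "w \<in> walks \<Gamma> a u x" "w' \<in> walks \<Gamma> b x v"
  shows "w @ tl w' \<in> walks \<Gamma> (a + b) u v"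
    and "walk_gain \<Psi> (w @ tl w') = walk_gain \<Psi> w + walk_gain \<Psi> w'"
proof -
  have ne: "w \<noteq> []" "w' \<noteq> []" "last w = hd w'" "hd w' = x"
    using assms by (auto simp: walks_def vwalk_def)
  then show "walk_gain \<Psi> (w @ tl w') = walk_gain \<Psi> w + walk_gain \<Psi> w'"
    by (intro walk_gain_append_tl)
  show "w @ tl w' \<in> walks \<Gamma> (a + b) u v"
  proof (cases "tl w' = []")
    case True
    with assms ne show ?thesis by (cases w') (auto simp: walks_def)
  next
    case False
    with assms ne show ?thesis
      by (cases w') (auto simp: walks_def vwalk_def vwalk_arcs_append)
  qed
qed

lemma edge_in_walks:
  assumes "pair_wf_digraph \<Gamma>" "(u, v) \<in> parcs \<Gamma>"
  shows "[u, v] \<in> walks \<Gamma> 1 u v"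
  using assms pair_wf_digraph.wellformed' by (fastforce simp: walks_def vwalk_def)

text \<open>The last step is split off, matching the recursion
  \<open>A ^\<^sub>m Suc h = A ^\<^sub>m h * A\<close>. Restricting \<open>x\<close> to
  \<open>pverts\<close> makes the union finite and loses nothing, since arcs join vertices.\<close>

lemma walks_Suc:
  assumes "pair_wf_digraph \<Gamma>"
  shows "walks \<Gamma> (Suc h) u v =
    (\<Union>x\<in>{x \<in> pverts \<Gamma>. (x, v) \<in> parcs \<Gamma>}. (\<lambda>w. w @ [v]) ` walks \<Gamma> h u x)"
proof (intro equalityI subsetI)
  fix w assume w: "w \<in> walks \<Gamma> (Suc h) u v"
  then obtain w' where w': "w = w' @ [v]" "w' \<noteq> []"
    by (cases w rule: rev_cases) (force simp: walks_def)+
  with w have "(last w', v) \<in> parcs \<Gamma>" "w' \<in> walks \<Gamma> h u (last w')"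
    by (auto simp: walks_def vwalk_def vwalk_arcs_append)
  with w' pair_wf_digraph.wellformed'[OF assms]
  show "w \<in> (\<Union>x\<in>{x \<in> pverts \<Gamma>. (x, v) \<in> parcs \<Gamma>}. (\<lambda>w. w @ [v]) ` walks \<Gamma> h u x)"
    by blast
next
  fix w assume "w \<in> (\<Union>x\<in>{x \<in> pverts \<Gamma>. (x, v) \<in> parcs \<Gamma>}. (\<lambda>w. w @ [v]) ` walks \<Gamma> h u x)"
  then obtain x w' where "(x, v) \<in> parcs \<Gamma>" "w' \<in> walks \<Gamma> h u x" "w = w' @ [v]" by blast
  then show "w \<in> walks \<Gamma> (Suc h) u v"
    using walks_append_tl(1)[OF _ edge_in_walks[OF assms]] by fastforce
qed

text \<open>Each step changes sides. As \<open>length w\<close> counts vertices, an odd list length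
  means an even number of steps.\<close>

lemma bipartite_walk_parity:
  assumes "vwalk w (with_proj \<Gamma>)" "U \<inter> W = {}" "pverts \<Gamma> = U \<union> W"
    and "parcs \<Gamma> \<subseteq> U \<times> W \<union> W \<times> U"
  shows "(hd w \<in> U \<longleftrightarrow> last w \<in> U) \<longleftrightarrow> odd (length w)"
  using assms(1)
proof (induction w rule: vwalk_induct)
  case (Cons u v es)
  then have "u \<in> U \<longleftrightarrow> v \<notin> U" using assms by auto
  with Cons show ?case by auto
qed simp

lemma bipartite_closed_walk_even:
  assumes "bipartite \<Gamma>" "w \<in> walks \<Gamma> h u u"
  shows "even h"
  using assms bipartite_walk_parity[of w \<Gamma>]
  by (auto simp: bipartite_def walks_def)

section \<open>Counting walks: convolution, symmetry and growth\<close>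

context pair_graph
begin

lemma finite_walks: "finite (walks G h u v)"
proof (induction h arbitrary: v)
  case (Suc h)
  then show ?case using pair_finite_verts by (simp add: walks_Suc[OF pair_wf_digraph])
qed (simp add: walks_0)

lemma sum_walks_Suc:
  "(\<Sum>w\<in>walks G (Suc h) u v. f w) =
    (\<Sum>x\<in>pverts G. if (x, v) \<in> parcs G then \<Sum>w\<in>walks G h u x. f (w @ [v]) else 0)"
proof -
  have "(\<Sum>w\<in>walks G (Suc h) u v. f w) =
    (\<Sum>x\<in>{x \<in> pverts G. (x, v) \<in> parcs G}. \<Sum>w\<in>(\<lambda>w. w @ [v]) ` walks G h u x. f w)"
    unfolding walks_Suc[OF pair_wf_digraph]
    by (intro sum.UNION_disjoint ballI finite_imageI finite_walks)
      (auto simp: pair_finite_verts walks_def)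
  also have "\<dots> = (\<Sum>x\<in>{x \<in> pverts G. (x, v) \<in> parcs G}. \<Sum>w\<in>walks G h u x. f (w @ [v]))"
    by (rule sum.cong[OF refl]) (simp add: sum.reindex inj_on_def)
  finally show ?thesis
    by (simp add: sum.inter_filter pair_finite_verts)
qed

lemma card_walks_Suc:
  "card (walks G (Suc h) u v) =
    (\<Sum>x\<in>pverts G. card (walks G h u x) * (if (x, v) \<in> parcs G then 1 else 0))"
  using sum_walks_Suc[of "\<lambda>_. 1 :: nat" h u v] by (simp add: if_distrib cong: if_cong)

text \<open>This is the product of two powers of the 0/1 adjacency matrix. In the base case,
  \<open>v \<in> pverts G\<close> lets the sum pick out the term \<open>x = v\<close>.\<close>

lemma card_walks_add:
  assumes "v \<in> pverts G"
  shows "card (walks G (a + b) u v) =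
    (\<Sum>x\<in>pverts G. card (walks G a u x) * card (walks G b x v))"
  using assms
proof (induction b arbitrary: v)
  case 0
  then show ?case
    by (simp add: walks_0 if_distrib pair_finite_verts cong: if_cong)
next
  case (Suc b)
  have "card (walks G (a + Suc b) u v) =
    (\<Sum>y\<in>pverts G. (\<Sum>x\<in>pverts G. card (walks G a u x) * card (walks G b x y)) *
      (if (y, v) \<in> parcs G then 1 else 0))"
    by (simp add: card_walks_Suc Suc.IH)
  also have "\<dots> = (\<Sum>x\<in>pverts G. card (walks G a u x) * card (walks G (Suc b) x v))"
    unfolding card_walks_Suc sum_distrib_left sum_distrib_right
    by (subst sum.swap) (simp add: mult.assoc)
  finally show ?case .
qed

text \<open>Instead of reversing walks, one side is split at its last step and the other at its
  first (\<open>card_walks_add\<close> with \<open>a = 1\<close>); symmetry of the arcs and the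
  induction hypothesis match the terms.\<close>

lemma card_walks_sym:
  assumes "u \<in> pverts G" "v \<in> pverts G"
  shows "card (walks G h u v) = card (walks G h v u)"
  using assms
proof (induction h arbitrary: v)
  case (Suc h)
  have "card (walks G 1 v x) = (if (x, v) \<in> parcs G then 1 else 0)" if "x \<in> pverts G" for x
    using card_walks_Suc[of 0 v x] Suc.prems arcs_symmetric[of x v] arcs_symmetric[of v x]
    by (auto simp: walks_0 if_distrib[of card] if_distrib[of "\<lambda>n. n * _"] pair_finite_verts
        cong: if_cong)
  then show ?case
    using card_walks_add[of u 1 h v] Suc
    by (simp add: card_walks_Suc mult.commute)
qed (auto simp: walks_0)

lemma closed_walks_eq: "closed_walks G h = (\<Union>v\<in>pverts G. walks G h v v)"
  using walks_hd_in_verts by (fastforce simp: closed_walks_iff walks_def)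

lemma finite_closed_walks: "finite (closed_walks G h)"
  by (simp add: closed_walks_eq finite_walks pair_finite_verts)

lemma sum_closed_walks:
  "(\<Sum>w\<in>closed_walks G h. f w) = (\<Sum>v\<in>pverts G. \<Sum>w\<in>walks G h v v. f w)"
  unfolding closed_walks_eq
  by (intro sum.UNION_disjoint ballI finite_walks) (auto simp: pair_finite_verts walks_def)

text \<open>A closed walk based at \<open>u\<close> is cut at the vertex \<open>v\<close> reached
  after \<open>a\<close> steps. Symmetry turns the returning piece around, so \<open>a = b\<close>
  yields squares.\<close>

lemma card_closed_walks_add:
  "card (closed_walks G (a + b)) =
    (\<Sum>u\<in>pverts G. \<Sum>v\<in>pverts G. card (walks G a u v) * card (walks G b u v))"
  using sum_closed_walks[of "\<lambda>_. 1 :: nat" "a + b"]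
  by (auto simp: card_walks_add card_walks_sym intro!: sum.cong)

lemma card_closed_walks_double:
  "card (closed_walks G (2 * h)) = (\<Sum>u\<in>pverts G. \<Sum>v\<in>pverts G. (card (walks G h u v))\<^sup>2)"
  using card_closed_walks_add[of h h] by (simp add: mult_2 power2_eq_square)

text \<open>A walk of length \<open>Suc h\<close> from \<open>u\<close> extends one of length
  \<open>h\<close> from \<open>u\<close>. Cauchy-Schwarz over the last vertex of the shorter walk
  costs one factor \<open>card (pverts G)\<close>, and summing over \<open>v\<close> costs the
  other.\<close>

lemma card_closed_walks_double_Suc:
  "card (closed_walks G (2 * Suc h)) \<le> (card (pverts G))\<^sup>2 * card (closed_walks G (2 * h))"
proof -
  let ?V = "pverts G"
  have *: "(card (walks G (Suc h) u v))\<^sup>2 \<le> card ?V * (\<Sum>x\<in>?V. (card (walks G h u x))\<^sup>2)"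
    for u v
  proof -
    have "card (walks G (Suc h) u v) \<le> (\<Sum>x\<in>?V. card (walks G h u x))"
      unfolding card_walks_Suc by (intro sum_mono) auto
    then have "real ((card (walks G (Suc h) u v))\<^sup>2) \<le> (\<Sum>x\<in>?V. real (card (walks G h u x)))\<^sup>2"
      by (metis of_nat_mono of_nat_power of_nat_sum power_mono zero_le)
    also have "\<dots> \<le> (\<Sum>x\<in>?V. (real (card (walks G h u x)))\<^sup>2) * card ?V"
      by (rule sum_squared_le_sum_of_squares)
    finally have "real ((card (walks G (Suc h) u v))\<^sup>2)
        \<le> real (card ?V * (\<Sum>x\<in>?V. (card (walks G h u x))\<^sup>2))"
      by (simp add: mult.commute)
    then show ?thesis by (simp only: of_nat_le_iff)
  qed
  have "card (closed_walks G (2 * Suc h)) \<le>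
      (\<Sum>u\<in>?V. \<Sum>v\<in>?V. card ?V * (\<Sum>x\<in>?V. (card (walks G h u x))\<^sup>2))"
    unfolding card_closed_walks_double by (intro sum_mono *)
  also have "\<dots> = (card ?V)\<^sup>2 * card (closed_walks G (2 * h))"
    by (simp add: card_closed_walks_double sum_distrib_left power2_eq_square mult.assoc)
  finally show ?thesis .
qed

text \<open>With \<open>2 * h + 1 = h + Suc h\<close>, the inequality
  \<open>a * b \<le> a\<^sup>2 + b\<^sup>2\<close> bounds the odd count by the two neighbouring even
  counts.\<close>

lemma card_closed_walks_odd:
  "card (closed_walks G (2 * h + 1)) \<le> (1 + (card (pverts G))\<^sup>2) * card (closed_walks G (2 * h))"
proof -
  have *: "a * b \<le> a\<^sup>2 + b\<^sup>2" for a b :: nat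
  proof (cases "a \<le> b")
    case True
    then have "a * b \<le> b * b" by (rule mult_right_mono) simp
    then show ?thesis unfolding power2_eq_square by (rule trans_le_add2)
  next
    case False
    then have "a * b \<le> a * a" by (intro mult_left_mono) auto
    then show ?thesis unfolding power2_eq_square by (rule trans_le_add1)
  qed
  have "card (closed_walks G (2 * h + 1)) \<le>
      card (closed_walks G (2 * h)) + card (closed_walks G (2 * Suc h))"
    using card_closed_walks_add[of h "Suc h"]
    unfolding card_closed_walks_double
    by (simp add: mult_2 sum.distrib[symmetric]) (intro sum_mono *)
  with card_closed_walks_double_Suc[of h] show ?thesis by simp
qed

text \<open>The constant depends on \<open>L\<close> but not on \<open>h\<close>. The reference
  length is even because odd counts vanish in bipartite graphs and could not serve as a bound
  there.\<close>

lemma card_closed_walks_growth: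
  "\<exists>K. \<forall>h. card (closed_walks G (2 * h + L)) \<le> K * card (closed_walks G (2 * h))"
proof (induction L rule: nat_induct2)
  case 0
  show ?case by (intro exI[of _ 1]) simp
next
  case 1
  show ?case using card_closed_walks_odd by blast
next
  case (step L)
  then obtain K where K: "card (closed_walks G (2 * h + L)) \<le> K * card (closed_walks G (2 * h))" for h
    by blast
  have "card (closed_walks G (2 * h + (L + 2))) \<le>
      (K * (card (pverts G))\<^sup>2) * card (closed_walks G (2 * h))" for h
  proof -
    \<comment> \<open>The two extra steps are moved into the even part:
      \<open>2 * h + (L + 2) = 2 * Suc h + L\<close>.\<close>
    have "card (closed_walks G (2 * h + (L + 2))) \<le> K * card (closed_walks G (2 * Suc h))"
      using K[of "Suc h"] by (simp add: add.commute add.left_commute)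
    also have "\<dots> \<le> K * ((card (pverts G))\<^sup>2 * card (closed_walks G (2 * h)))"
      by (intro mult_left_mono card_closed_walks_double_Suc) simp
    finally show ?thesis by (simp add: mult.assoc)
  qed
  then show ?case by blast
qed

lemma closed_walks_even_nonempty:
  assumes "(u, x) \<in> parcs G"
  shows "walks G (2 * h) u u \<noteq> {}"
proof (induction h)
  case 0
  then show ?case using assms in_arcsD1 by (auto simp: walks_0)
next
  case (Suc h)
  then obtain w where "w \<in> walks G (2 * h) u u" by blast
  with assms show ?case
    using walks_append_tl(1)[OF walks_append_tl(1)[OF _ edge_in_walks[OF pair_wf_digraph assms]]
        edge_in_walks[OF pair_wf_digraph arcs_symmetric[OF assms]]]
    by fastforce
qed

end

section \<open>Traces of powers of the adjacency matrix\<close>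

lemma (in pair_graph) index_pow_adjacency_matrix:
  fixes \<Psi> :: "'a \<times> 'a \<Rightarrow> 'g :: group_add"
  assumes vs: "distinct vs" "set vs = pverts G"
    and "i < length vs" "j < length vs"
  shows "(adjacency_matrix G \<Psi> vs ^\<^sub>m h) $$ (i, j) =
    (\<Sum>w\<in>walks G h (vs ! i) (vs ! j). Poly_Mapping.single (walk_gain \<Psi> w) 1)"
  using assms(4)
proof (induction h arbitrary: j)
  case 0
  with assms show ?case
    by (auto simp: adjacency_matrix_def walks_0 nth_eq_iff_index_eq nth_mem[of _ vs, unfolded vs(2)])
next
  case (Suc h)
  let ?A = "adjacency_matrix G \<Psi> vs" and ?n = "length vs"
  let ?f = "\<lambda>x. if (x, vs ! j) \<in> parcs G
    then \<Sum>w\<in>walks G h (vs ! i) x. Poly_Mapping.single (walk_gain \<Psi> (w @ [vs ! j])) (1 :: complex)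
    else 0"
  have A: "?A \<in> carrier_mat ?n ?n" by (simp add: adjacency_matrix_def)
  \<comment> \<open>The new gain enters on the right, as does the last factor in
    \<open>?A ^\<^sub>m h * ?A\<close>; the order matters in a noncommutative group.\<close>
  have gain: "walk_gain \<Psi> (w @ [vs ! j]) = walk_gain \<Psi> w + \<Psi> (x, vs ! j)"
    if "w \<in> walks G h (vs ! i) x" for w x
    using that walk_gain_append_tl[of w "[x, vs ! j]" \<Psi>] by (auto simp: walks_def walk_gain_def)
  have "(?A ^\<^sub>m Suc h) $$ (i, j) = (\<Sum>k = 0..<?n. (?A ^\<^sub>m h) $$ (i, k) * ?A $$ (k, j))"
    using A assms Suc.prems by (simp add: scalar_prod_def)
  also have "\<dots> = (\<Sum>k = 0..<?n. ?f (vs ! k))"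
  proof (intro sum.cong refl)
    fix k assume "k \<in> {0..<?n}"
    \<comment> \<open>\<open>adjacency_matrix\<close> is unfolded only at the entry
      \<open>(k, j)\<close>, so that the power stays intact for the induction hypothesis.\<close>
    then show "(?A ^\<^sub>m h) $$ (i, k) * ?A $$ (k, j) = ?f (vs ! k)"
      using Suc by (simp add: adjacency_matrix_def[of _ _ vs, THEN arg_cong[of _ _ "\<lambda>M. M $$ (k, j)"]]
          sum_distrib_right mult_single gain cong: sum.cong)
  qed
  also have "\<dots> = (\<Sum>x\<in>pverts G. ?f x)"
    using sum.reindex_bij_betw[OF bij_betw_nth[OF vs(1) refl vs(2)[symmetric]], of ?f]
    by (simp add: lessThan_atLeast0)
  also have "\<dots> = (\<Sum>w\<in>walks G (Suc h) (vs ! i) (vs ! j). Poly_Mapping.single (walk_gain \<Psi> w) 1)"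
    by (simp add: sum_walks_Suc)
  finally show ?case .
qed

text \<open>\<open>algebra_Tr\<close> reads off the coefficient of the identity, so a closed walk
  contributes 1 if its gain is trivial and 0 otherwise.\<close>

lemma (in pair_graph) Tr_pow_adjacency_matrix:
  assumes vs: "distinct vs" "set vs = pverts G"
  shows "Tr (adjacency_matrix G \<Psi> vs ^\<^sub>m h) = of_nat (card (balanced_closed_walks G \<Psi> h))"
proof -
  let ?f = "\<lambda>w. if walk_gain \<Psi> w = 0 then 1 else 0 :: complex"
  have "Tr (adjacency_matrix G \<Psi> vs ^\<^sub>m h) =
      (\<Sum>i<length vs. \<Sum>w\<in>walks G h (vs ! i) (vs ! i). ?f w)"
    by (simp add: Tr_def algebra_Tr_def index_pow_adjacency_matrix[OF vs] lookup_sum lookup_single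
        adjacency_matrix_def[of _ _ vs, THEN arg_cong[of _ _ dim_row]] when_def)
  also have "\<dots> = (\<Sum>v\<in>pverts G. \<Sum>w\<in>walks G h v v. ?f w)"
    using sum.reindex_bij_betw[OF bij_betw_nth[OF vs(1) refl vs(2)[symmetric]],
        of "\<lambda>v. \<Sum>w\<in>walks G h v v. ?f w"] .
  also have "\<dots> = of_nat (card (balanced_closed_walks G \<Psi> h))"
    unfolding sum_closed_walks[symmetric] balanced_closed_walks_def
    by (simp add: sum.inter_filter[symmetric] finite_closed_walks)
  finally show ?thesis .
qed

lemma balanced_closed_walks_trivial_gain:
  "balanced_closed_walks \<Gamma> trivial_gain h = closed_walks \<Gamma> h"
  by (auto simp: balanced_closed_walks_def walk_gain_def trivial_gain_def sum_list_0)

section \<open>Unbalanced closed walks of a common length at all vertices\<close>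

context gain_graph
begin

lemma back_and_forth_walk:
  assumes "(u, x) \<in> parcs \<Gamma>"
  shows "[u, x, u] \<in> walks \<Gamma> 2 u u" "walk_gain \<Psi> [u, x, u] = 0"
proof -
  show "[u, x, u] \<in> walks \<Gamma> 2 u u"
    using walks_append_tl(1)[OF edge_in_walks[OF pair_wf_digraph assms]
        edge_in_walks[OF pair_wf_digraph arcs_symmetric[OF assms]]] by (simp add: numeral_2_eq_2)
  show "walk_gain \<Psi> [u, x, u] = 0"
    using gain_inverse[OF assms] by (simp add: walk_gain_def)
qed

definition unbalanced_at :: "'v \<Rightarrow> nat \<Rightarrow> bool" where
  "unbalanced_at u m \<longleftrightarrow> (\<exists>w\<in>walks \<Gamma> m u u. walk_gain \<Psi> w \<noteq> 0)"

text \<open>A walk with nontrivial gain has a first edge. Going back and forth along it at the end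
  adds two steps and leaves the gain unchanged.\<close>

lemma unbalanced_at_add2:
  assumes "unbalanced_at u m"
  shows "unbalanced_at u (m + 2)"
proof -
  obtain w where w: "w \<in> walks \<Gamma> m u u" "walk_gain \<Psi> w \<noteq> 0"
    using assms by (auto simp: unbalanced_at_def)
  then obtain x ys where "w = u # x # ys"
    by (cases w; cases "tl w") (auto simp: walks_def vwalk_def)
  with w have "(u, x) \<in> parcs \<Gamma>" by (auto simp: walks_def vwalk_def)
  then show ?thesis
    using walks_append_tl(1)[OF w(1) back_and_forth_walk(1)]
      walks_append_tl(2)[OF w(1) back_and_forth_walk(1), of x \<Psi>] back_and_forth_walk(2)[of u x] w(2)
    unfolding unbalanced_at_def by (metis add_0_right)
qed

text \<open>Stepping from \<open>x\<close> to \<open>u\<close> before the walk and back after it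
  conjugates the gain, and a conjugate of a nonidentity element is not the identity.\<close>

lemma unbalanced_at_neighbour:
  assumes "unbalanced_at u m" "(u, x) \<in> parcs \<Gamma>"
  shows "unbalanced_at x (m + 2)"
proof -
  obtain w where w: "w \<in> walks \<Gamma> m u u" "walk_gain \<Psi> w \<noteq> 0"
    using assms by (auto simp: unbalanced_at_def)
  note e = edge_in_walks[OF pair_wf_digraph arcs_symmetric[OF assms(2)]]
    and e' = edge_in_walks[OF pair_wf_digraph assms(2)]
  have "\<Psi> (x, u) + walk_gain \<Psi> w + \<Psi> (u, x) \<noteq> 0"
  proof
    assume "\<Psi> (x, u) + walk_gain \<Psi> w + \<Psi> (u, x) = 0"
    then have "\<Psi> (x, u) + walk_gain \<Psi> w = \<Psi> (x, u)"
      by (simp add: gain_inverse[OF assms(2)] eq_neg_iff_add_eq_0[symmetric])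
    with w(2) show False by (metis add_0_right add_left_cancel)
  qed
  moreover have "([x, u] @ tl w) @ tl [u, x] \<in> walks \<Gamma> (1 + m + 1) x x"
    by (rule walks_append_tl[OF walks_append_tl(1)[OF e w(1)] e'])
  moreover have "walk_gain \<Psi> (([x, u] @ tl w) @ tl [u, x]) = \<Psi> (x, u) + walk_gain \<Psi> w + \<Psi> (u, x)"
    by (subst walks_append_tl(2)[OF walks_append_tl(1)[OF e w(1)] e'],
        subst walks_append_tl(2)[OF e w(1)]) (simp add: walk_gain_def)
  ultimately show ?thesis
    unfolding unbalanced_at_def by (metis Suc_eq_plus1 add_2_eq_Suc' plus_1_eq_Suc add_Suc)
qed

text \<open>Each edge of a path costs two steps, so the least length obtained depends on
  \<open>v\<close>. Claiming all large \<open>j\<close> allows the claims for finitely many vertices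
  to be combined.\<close>

lemma unbalanced_at_reachable:
  assumes "unbalanced_at u m" "u \<rightarrow>\<^sup>*\<^bsub>with_proj \<Gamma>\<^esub> v"
  shows "eventually (\<lambda>j. unbalanced_at v (m + 2 * j)) sequentially"
  using assms(2)
proof (induction rule: reachable_induct)
  case base
  have "unbalanced_at u (m + 2 * j)" for j
    by (induction j) (use assms(1) unbalanced_at_add2 in \<open>auto simp: add.commute add.left_commute\<close>)
  then show ?case by simp
next
  case (step x y)
  then have xy: "(x, y) \<in> parcs \<Gamma>" by simp
  from step(3) have "eventually (\<lambda>j. unbalanced_at y (m + 2 * Suc j)) sequentially"
    by (rule eventually_mono) (use unbalanced_at_neighbour[OF _ xy] in fastforce)
  then show ?case by (subst (asm) eventually_sequentially_Suc)
qed

lemma unbalanced_at_uniform_length: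
  assumes "Digraph_Component.connected (with_proj \<Gamma>)" "\<not> balanced \<Gamma> \<Psi>"
  obtains L where "\<And>v. v \<in> pverts \<Gamma> \<Longrightarrow> unbalanced_at v L"
proof -
  obtain w m where w: "w \<in> walks \<Gamma> m (hd w) (hd w)" "walk_gain \<Psi> w \<noteq> 0"
    using assms(2) by (auto simp: balanced_def closed_walks_iff)
  define u where "u = hd w"
  have um: "unbalanced_at u m" "u \<in> pverts \<Gamma>"
    using w walks_hd_in_verts[OF w(1)] unfolding unbalanced_at_def u_def by auto
  \<comment> \<open>\<open>connected\<close> refers to the symmetric closure; since the arcs are
    already symmetric, directed paths lead from \<open>u\<close> to every vertex.\<close>
  have "strongly_connected (with_proj \<Gamma>)"
    using symmetric_connected_imp_strongly_connected pair_sym_arcs assms(1) by blast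
  then have "\<forall>v\<in>pverts \<Gamma>. eventually (\<lambda>j. unbalanced_at v (m + 2 * j)) sequentially"
    using um unbalanced_at_reachable by (auto simp: strongly_connected_def)
  then have "eventually (\<lambda>j. \<forall>v\<in>pverts \<Gamma>. unbalanced_at v (m + 2 * j)) sequentially"
    by (simp add: eventually_ball_finite pair_finite_verts)
  then obtain j where "\<forall>v\<in>pverts \<Gamma>. unbalanced_at v (m + 2 * j)"
    by (auto simp: eventually_sequentially)
  then show thesis using that by blast
qed

lemma balanced_walks_inject_unbalanced:
  assumes L: "\<And>v. v \<in> pverts \<Gamma> \<Longrightarrow> unbalanced_at v L"
  shows "card (balanced_closed_walks \<Gamma> \<Psi> h) + card (balanced_closed_walks \<Gamma> \<Psi> (h + L))
    \<le> card (closed_walks \<Gamma> (h + L))"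
proof -
  obtain C where C: "\<And>v. v \<in> pverts \<Gamma> \<Longrightarrow> C v \<in> walks \<Gamma> L v v \<and> walk_gain \<Psi> (C v) \<noteq> 0"
    using L unfolding unbalanced_at_def by metis
  let ?B = "balanced_closed_walks \<Gamma> \<Psi>"
  let ?ext = "\<lambda>w. w @ tl (C (hd w))"
  \<comment> \<open>All walks in \<open>?B h\<close> have \<open>h + 1\<close> vertices, so
    \<open>w\<close> is recovered as a prefix of fixed length.\<close>
  have "inj_on ?ext (?B h)"
    by (intro inj_onI) (auto simp: balanced_closed_walks_def closed_walks_def)
  moreover have "?ext ` ?B h \<subseteq> closed_walks \<Gamma> (h + L) - ?B (h + L)"
  proof (intro image_subsetI)
    fix w assume "w \<in> ?B h"
    then have w: "w \<in> walks \<Gamma> h (hd w) (hd w)" "walk_gain \<Psi> w = 0"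
      by (auto simp: balanced_closed_walks_def closed_walks_iff)
    have C': "C (hd w) \<in> walks \<Gamma> L (hd w) (hd w)" "walk_gain \<Psi> (C (hd w)) \<noteq> 0"
      using C[OF walks_hd_in_verts[OF w(1)]] by simp_all
    have "?ext w \<in> closed_walks \<Gamma> (h + L)"
      using walks_append_tl(1)[OF w(1) C'(1)] walks_subset_closed_walks by (rule rev_subsetD)
    moreover have "walk_gain \<Psi> (?ext w) \<noteq> 0"
      using C'(2) unfolding walks_append_tl(2)[OF w(1) C'(1)] w(2) by simp
    ultimately show "?ext w \<in> closed_walks \<Gamma> (h + L) - ?B (h + L)"
      by (simp add: balanced_closed_walks_def)
  qed
  ultimately have "card (?B h) \<le> card (closed_walks \<Gamma> (h + L) - ?B (h + L))"
    by (metis card_mono card_image finite_Diff finite_closed_walks)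
  moreover have "?B (h + L) \<subseteq> closed_walks \<Gamma> (h + L)" by (auto simp: balanced_closed_walks_def)
  ultimately show ?thesis
    using finite_closed_walks card_mono[of "closed_walks \<Gamma> (h + L)" "?B (h + L)"]
    by (simp add: card_Diff_subset finite_subset)
qed

text \<open>The hypothesis clears denominators and covers both cases of (iii) at once: in a
  bipartite graph only even lengths are constrained.\<close>

lemma balanced_if_ratio_tends_to_1:
  assumes conn: "Digraph_Component.connected (with_proj \<Gamma>)"
    and ratio: "\<And>\<epsilon>. \<epsilon> > 0 \<Longrightarrow> \<exists>N. \<forall>h\<ge>N. (bipartite \<Gamma> \<longrightarrow> even h) \<longrightarrow> closed_walks \<Gamma> h \<noteq> {} \<longrightarrow>
      real (card (balanced_closed_walks \<Gamma> \<Psi> h)) > (1 - \<epsilon>) * real (card (closed_walks \<Gamma> h))"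
  shows "balanced \<Gamma> \<Psi>"
proof (rule ccontr)
  assume nb: "\<not> balanced \<Gamma> \<Psi>"
  let ?b = "\<lambda>h. real (card (balanced_closed_walks \<Gamma> \<Psi> h))"
    and ?c = "\<lambda>h. real (card (closed_walks \<Gamma> h))"
  obtain L where L: "\<And>v. v \<in> pverts \<Gamma> \<Longrightarrow> unbalanced_at v L"
    using unbalanced_at_uniform_length[OF conn nb] by blast
  obtain u where u: "u \<in> pverts \<Gamma>"
    using conn by (auto simp: connected_conv)
  then obtain w where w: "w \<in> walks \<Gamma> L u u" "walk_gain \<Psi> w \<noteq> 0"
    using L unfolding unbalanced_at_def by blast
  then obtain x ys where "w = u # x # ys"
    by (cases w; cases "tl w") (auto simp: walks_def vwalk_def)
  with w have ux: "(u, x) \<in> parcs \<Gamma>" by (auto simp: walks_def vwalk_def)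
  obtain K where K: "\<And>h. card (closed_walks \<Gamma> (2 * h + L)) \<le> K * card (closed_walks \<Gamma> (2 * h))"
    using card_closed_walks_growth by blast
  have parity: "even L" if "bipartite \<Gamma>"
    using bipartite_closed_walk_even[OF that w(1)] .
  \<comment> \<open>Chosen so that \<open>?c (h + L) \<le> (real K + 1) * ?c h\<close> gives
    \<open>\<epsilon> * ?c (h + L) \<le> ?c h / 2\<close>; the summand 1 keeps the denominator
    positive when \<open>K = 0\<close>.\<close>
  define \<epsilon> where "\<epsilon> = 1 / (2 * (real K + 1))"
  have \<epsilon>: "\<epsilon> > 0" by (simp add: \<epsilon>_def)
  have half: "(1/2 :: real) > 0" by simp
  obtain N1 where N1: "\<forall>h\<ge>N1. (bipartite \<Gamma> \<longrightarrow> even h) \<longrightarrow> closed_walks \<Gamma> h \<noteq> {} \<longrightarrow>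
      ?b h > (1 - 1/2) * ?c h"
    using ratio[OF half] by (rule exE)
  obtain N2 where N2: "\<forall>h\<ge>N2. (bipartite \<Gamma> \<longrightarrow> even h) \<longrightarrow> closed_walks \<Gamma> h \<noteq> {} \<longrightarrow>
      ?b h > (1 - \<epsilon>) * ?c h"
    using ratio[OF \<epsilon>] by (rule exE)
  \<comment> \<open>An even length beyond both thresholds; \<open>h + L\<close> is then also beyond
    them, and even in the bipartite case.\<close>
  define h where "h = 2 * (N1 + N2)"
  have ne: "closed_walks \<Gamma> h \<noteq> {}"
    using closed_walks_even_nonempty[OF ux, of "N1 + N2"]
      walks_subset_closed_walks[of \<Gamma> "2 * (N1 + N2)" u] by (auto simp: h_def)
  then have b: "?b h > ?c h / 2" using N1[rule_format, of h] by (simp add: h_def)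
  have sum: "?b h + ?b (h + L) \<le> ?c (h + L)"
    using balanced_walks_inject_unbalanced[OF L, of h] by (metis of_nat_add of_nat_le_iff)
  \<comment> \<open>The extended walks show that the count at \<open>h + L\<close> is nonzero, as
    the bound from \<open>N2\<close> requires.\<close>
  have "?c h \<ge> 0" "?b (h + L) \<ge> 0" by simp_all
  with sum b have "?c (h + L) > 0" by linarith
  then have "closed_walks \<Gamma> (h + L) \<noteq> {}" by auto
  then have b': "?b (h + L) > (1 - \<epsilon>) * ?c (h + L)"
    using N2[rule_format, of "h + L"] parity by (simp add: h_def)
  have "?c (h + L) \<le> (real K + 1) * ?c h"
  proof -
    have "?c (h + L) \<le> real K * ?c h"
      using K[of "N1 + N2"] unfolding h_def by (metis of_nat_le_iff of_nat_mult)
    then show ?thesis by (simp add: algebra_simps)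
  qed
  then have "\<epsilon> * ?c (h + L) \<le> ?c h / 2"
    by (simp add: \<epsilon>_def field_simps)
  \<comment> \<open>The contradiction is the cycle \<open>?c (h + L) - ?b (h + L) < \<epsilon> * ?c
    (h + L) \<le> ?c h / 2 < ?b h \<le> ?c (h + L) - ?b (h + L)\<close>.\<close>
  with b b' sum show False by (simp add: algebra_simps)
qed

end

section \<open>Limits of quotients and the equivalence of the three conditions\<close>

lemma quotient_tends_to_1_of_nat:
  assumes "quotient_tends_to_1 (\<lambda>h. of_nat (b h)) (\<lambda>h. of_nat (c h))" "\<epsilon> > 0"
  shows "\<exists>N. \<forall>h\<ge>N. c h \<noteq> 0 \<longrightarrow> real (b h) > (1 - \<epsilon>) * real (c h)"
proof -
  have "\<exists>N. \<forall>h\<ge>N. c h \<noteq> 0 \<longrightarrow> dist (of_nat (b h) / of_nat (c h) :: complex) 1 < \<epsilon>"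
    using assms unfolding quotient_tends_to_1_def of_nat_eq_0_iff by simp
  then obtain N where
    N: "\<And>h. h \<ge> N \<Longrightarrow> c h \<noteq> 0 \<Longrightarrow> dist (of_nat (b h) / of_nat (c h) :: complex) 1 < \<epsilon>"
    by blast
  have "real (b h) > (1 - \<epsilon>) * real (c h)" if "h \<ge> N" "c h \<noteq> 0" for h
  proof -
    \<comment> \<open>The quotient is real, so its complex distance to 1 is an absolute value, of
      which only the lower bound is kept.\<close>
    have "of_nat (b h) / of_nat (c h) - 1 = complex_of_real (real (b h) / real (c h) - 1)" by simp
    then have "\<bar>real (b h) / real (c h) - 1\<bar> < \<epsilon>"
      using N[OF that] unfolding dist_norm by (metis norm_of_real)
    then have "1 - \<epsilon> < real (b h) / real (c h)" by linarith
    then show ?thesis using that by (simp add: pos_less_divide_eq)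
  qed
  then show ?thesis by blast
qed

lemma quotient_tends_to_1_refl: "quotient_tends_to_1 b b"
  by (auto simp: quotient_tends_to_1_def)

theorem theorem2:
  fixes \<Gamma> :: "'v pair_pre_digraph"
    and \<Psi> :: "'v \<times> 'v \<Rightarrow> 'g :: group_add"
    and vs :: "'v list"
    and A absA :: "'g group_algebra mat"
  assumes gain_graph: "gain_graph \<Gamma> \<Psi>"
    and connected: "Digraph_Component.connected (with_proj \<Gamma>)"
    and vertex_order: "distinct vs" "set vs = pverts \<Gamma>"
    and A: "A = adjacency_matrix \<Gamma> \<Psi> vs"
    and absA: "absA = adjacency_matrix \<Gamma> trivial_gain vs"
  defines "cond_i \<equiv> balanced \<Gamma> \<Psi>"
    and "cond_ii \<equiv> (\<forall>h\<ge>1. Tr (A ^\<^sub>m h) = Tr (absA ^\<^sub>m h))"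
    and "cond_iii \<equiv>
      (\<not> bipartite \<Gamma> \<longrightarrow>
        (\<forall>h\<ge>1. Tr (absA ^\<^sub>m h) \<noteq> 0 \<longrightarrow>
          Tr (A ^\<^sub>m h) / Tr (absA ^\<^sub>m h) =
          of_nat (card (balanced_closed_walks \<Gamma> \<Psi> h)) / of_nat (card (closed_walks \<Gamma> h))) \<and>
        quotient_tends_to_1 (\<lambda>h. Tr (A ^\<^sub>m h)) (\<lambda>h. Tr (absA ^\<^sub>m h)) \<and>
        quotient_tends_to_1 (\<lambda>h. of_nat (card (balanced_closed_walks \<Gamma> \<Psi> h)))
          (\<lambda>h. of_nat (card (closed_walks \<Gamma> h)))) \<and>
      (bipartite \<Gamma> \<longrightarrow>
        (\<forall>h\<ge>1. Tr (absA ^\<^sub>m (2 * h)) \<noteq> 0 \<longrightarrow>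
          Tr (A ^\<^sub>m (2 * h)) / Tr (absA ^\<^sub>m (2 * h)) =
          of_nat (card (balanced_closed_walks \<Gamma> \<Psi> (2 * h))) /
          of_nat (card (closed_walks \<Gamma> (2 * h)))) \<and>
        quotient_tends_to_1 (\<lambda>h. Tr (A ^\<^sub>m (2 * h))) (\<lambda>h. Tr (absA ^\<^sub>m (2 * h))) \<and>
        quotient_tends_to_1 (\<lambda>h. of_nat (card (balanced_closed_walks \<Gamma> \<Psi> (2 * h))))
          (\<lambda>h. of_nat (card (closed_walks \<Gamma> (2 * h)))))"
  shows "(cond_i \<longleftrightarrow> cond_ii) \<and> (cond_ii \<longleftrightarrow> cond_iii)"
proof -
  interpret gain_graph \<Gamma> \<Psi> by (rule gain_graph)
  let ?b = "\<lambda>h. card (balanced_closed_walks \<Gamma> \<Psi> h)" and ?c = "\<lambda>h. card (closed_walks \<Gamma> h)"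
  have trA: "Tr (A ^\<^sub>m h) = of_nat (?b h)" for h
    unfolding A by (rule Tr_pow_adjacency_matrix[OF vertex_order])
  have trabsA: "Tr (absA ^\<^sub>m h) = of_nat (?c h)" for h
    unfolding absA Tr_pow_adjacency_matrix[OF vertex_order] balanced_closed_walks_trivial_gain ..
  have i_iff: "balanced \<Gamma> \<Psi> \<longleftrightarrow> (\<forall>h\<ge>1. ?b h = ?c h)"
  proof
    assume "balanced \<Gamma> \<Psi>"
    then show "\<forall>h\<ge>1. ?b h = ?c h"
      by (auto simp: balanced_def balanced_closed_walks_def intro!: arg_cong[of _ _ card])
  next
    assume eq: "\<forall>h\<ge>1. ?b h = ?c h"
    \<comment> \<open>\<open>balanced\<close> includes \<open>h = 0\<close>, where a walk is a
      single vertex with trivial gain. For \<open>h \<ge> 1\<close>, a subset of a finite set with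
      the same cardinality is the whole set.\<close>
    have "walk_gain \<Psi> w = 0" if w: "w \<in> closed_walks \<Gamma> h" for h w
    proof (cases "h = 0")
      case True
      with w have "w = [hd w]" by (auto simp: closed_walks_iff walks_0 split: if_splits)
      then show ?thesis by (metis walk_gain_single)
    next
      case False
      then have "balanced_closed_walks \<Gamma> \<Psi> h = closed_walks \<Gamma> h"
        using eq by (intro card_subset_eq finite_closed_walks) (auto simp: balanced_closed_walks_def)
      with w show ?thesis by (auto simp: balanced_closed_walks_def)
    qed
    then show "balanced \<Gamma> \<Psi>" by (auto simp: balanced_def)
  qed
  have ii: "cond_ii \<longleftrightarrow> (\<forall>h\<ge>1. ?b h = ?c h)"
    by (simp add: cond_ii_def trA trabsA)
  \<comment> \<open>By the trace formulas, the identities between quotients hold outright and the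
    two convergence claims in each case coincide.\<close>
  have iii: "cond_iii \<longleftrightarrow>
      (\<not> bipartite \<Gamma> \<longrightarrow> quotient_tends_to_1 (\<lambda>h. of_nat (?b h)) (\<lambda>h. of_nat (?c h))) \<and>
      (bipartite \<Gamma> \<longrightarrow> quotient_tends_to_1 (\<lambda>h. of_nat (?b (2 * h))) (\<lambda>h. of_nat (?c (2 * h))))"
    by (simp add: cond_iii_def trA trabsA)
  have "cond_iii" if cond_i
  proof -
    have "?b h = ?c h" for h
      using that
      by (auto simp: cond_i_def balanced_def balanced_closed_walks_def intro!: arg_cong[of _ _ card])
    then show ?thesis by (simp add: iii quotient_tends_to_1_refl)
  qed
  moreover have cond_i if cond_iii
    unfolding cond_i_def
  proof (rule balanced_if_ratio_tends_to_1[OF connected])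
    fix \<epsilon> :: real assume \<epsilon>: "\<epsilon> > 0"
    show "\<exists>N. \<forall>h\<ge>N. (bipartite \<Gamma> \<longrightarrow> even h) \<longrightarrow> closed_walks \<Gamma> h \<noteq> {} \<longrightarrow>
      real (?b h) > (1 - \<epsilon>) * real (?c h)"
    proof (cases "bipartite \<Gamma>")
      case False
      with that have q: "quotient_tends_to_1 (\<lambda>h. of_nat (?b h)) (\<lambda>h. of_nat (?c h))"
        unfolding iii by blast
      from quotient_tends_to_1_of_nat[OF q \<epsilon>] False show ?thesis
        by (simp add: finite_closed_walks)
    next
      case True
      with that have q:
        "quotient_tends_to_1 (\<lambda>h. of_nat (?b (2 * h))) (\<lambda>h. of_nat (?c (2 * h)))"
        unfolding iii by blast
      obtain N where
        N: "\<And>h. h \<ge> N \<Longrightarrow> ?c (2 * h) \<noteq> 0 \<Longrightarrow> real (?b (2 * h)) > (1 - \<epsilon>) * real (?c (2 * h))"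
        using quotient_tends_to_1_of_nat[OF q \<epsilon>] by blast
      \<comment> \<open>The limit is indexed by half the length, so the threshold \<open>N\<close>
        becomes \<open>2 * N\<close> for the length itself.\<close>
      have "real (?b h) > (1 - \<epsilon>) * real (?c h)"
        if "h \<ge> 2 * N" "even h" "closed_walks \<Gamma> h \<noteq> {}" for h
        using that N[of "h div 2"] by (auto simp: finite_closed_walks)
      with True show ?thesis by blast
    qed
  qed
  ultimately show ?thesis
    using i_iff ii by (auto simp: cond_i_def)
qed

end
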